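(* If $|V|=6$, the complete graph $K_6$ on $V$ is B-factorizable. Equivalently, for every HAP table for $K_6$ (on 5 days), if $P(K_6,HA)$ is non-empty then it contains an integral point.
   Context: Let $V$ be a finite set with $|V|$ even. $K=\binom{V}{2}$ is the set of 2-element subsets of $V$. An equal partition of $V$ is an unordered pair $\{H,A\}$ of disjoint subsets with $H\cup A=V$ and $|H|=|A|=|V|/2$; $C=C(V)$ is the set of equal partitions. For $c=\{H,A\}\in C$, $B_c$ is the complete bipartite graph with parts $H$ and $A$. Vectors live in $\mathbb N^{K\cup C}$ with $\mathbb N=\{0,1,2,\dots\}$; $v|_K$ denotes the restriction to coordinates in $K$. For $E\subseteq K$, $\chi_E\in\{0,1\}^K$ is its indicator vector. For $E\subseteq K$ and $c\in C$, $\chi_{E,c}\in\mathbb N^{K\cup C}$ has $K$-components $\chi_E$ and $C$-components equal to the indicator of $c$. $PM(V)=\{\chi_{q,c}: c\in C,\ q\text{ a perfect matching of }B_c\}$. For $\mathcal M\subseteq\mathbb N^{K\cup C}$, $\mathbf N(\mathcal M)$ is the set of finite nonnegative integer combinations of elements of $\mathcal M$, and $\overline{\mathbf N}(\mathcal M)=\{v\in\mathbb N^{K\cup C}: kv\in\mathbf N(\mathcal M)\text{ for some integer }k\ge1\}$. A regular graph $G=(V,E)$ is B-factorizable if every $v\in\overline{\mathbf N}(PM(V))$ with $v|_K=\chi_E$ belongs to $\mathbf N(PM(V))$. For an $r$-regular graph $G=(V,E)$, a HAP table is a map assigning to each $d\in\{1,\dots,r\}$ an equal partition $\{H(d),A(d)\}\in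 C$. $P(G,HA)$ is the set of real vectors $(x_{e,d})_{e\in K,\,d\in\{1,\dots,r\}}$ satisfying: (1) $\sum_{d=1}^r x_{e,d}=1$ for every $e\in E$, and $x_{e,d}=0$ for every $e\in K\setminus E$ and every $d$; (2) for every $d$ and every $a\in V$, $\sum_{b\in V\setminus\{a\}}x_{\{a,b\},d}=1$; (3) $0\le x_{e,d}\le1$ for all $e\in E$ and all $d$; (4) $x_{\{a,b\},d}=0$ whenever $\{a,b\}\in E$ and $a,b$ are both in $H(d)$ or both in $A(d)$. *)

theory Defs
  imports Main
begin

definition pairsK :: "'a set \<Rightarrow> 'a set set" where
  "pairsK V = {e. e \<subseteq> V \<and> card e = 2}"

definition eqparts :: "'a set \<Rightarrow> 'a set set set" where
  "eqparts V = {{H, V - H} | H. H \<subseteq> V \<and> 2 * card H = card V}"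

type_synonym 'a coord = "'a set + 'a set set"
type_synonym 'a vec = "'a coord \<Rightarrow> nat"

definition coords :: "'a set \<Rightarrow> 'a coord set" where
  "coords V = Inl ` pairsK V \<union> Inr ` eqparts V"

definition vecs :: "'a set \<Rightarrow> 'a vec set" where
  "vecs V = {v. \<forall>i. i \<notin> coords V \<longrightarrow> v i = 0}"

definition bip_edges :: "'a set set \<Rightarrow> 'a set set" where
  "bip_edges c = {{h, a} | h a. \<exists>H\<in>c. \<exists>A\<in>c. H \<noteq> A \<and> h \<in> H \<and> a \<in> A}"

definition perfect_matching_B :: "'a set \<Rightarrow> 'a set set \<Rightarrow> 'a set set \<Rightarrow> bool" where
  "perfect_matching_B V c q \<longleftrightarrow> q \<subseteq> bip_edges c \<and> (\<forall>x\<in>V. \<exists>!e. e \<in> q \<and> x \<in> e)"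

definition chiK :: "'a set set \<Rightarrow> 'a set \<Rightarrow> nat" where
  "chiK E e = (if e \<in> E then 1 else 0)"

definition chiEc :: "'a set set \<Rightarrow> 'a set set \<Rightarrow> 'a vec" where
  "chiEc E c = (\<lambda>i. case i of Inl e \<Rightarrow> (if e \<in> E then 1 else 0)
                              | Inr d \<Rightarrow> (if d = c then 1 else 0))"

definition PM :: "'a set \<Rightarrow> 'a vec set" where
  "PM V = {chiEc q c | q c. c \<in> eqparts V \<and> perfect_matching_B V c q}"

definition Ncomb :: "'a vec set \<Rightarrow> 'a vec set" where
  "Ncomb M = {v. \<exists>S f. finite S \<and> S \<subseteq> M \<and> v = (\<lambda>i. \<Sum>m\<in>S. f m * m i)}"

definition Nbar :: "'a set \<Rightarrow> 'a vec set \<Rightarrow> 'a vec set" where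
  "Nbar V M = {v \<in> vecs V. \<exists>k::nat. k \<ge> 1 \<and> (\<lambda>i. k * v i) \<in> Ncomb M}"

text \<open>B-factorizability of a (regular) graph G = (V,E), E \<subseteq> K.\<close>
definition B_factorizable :: "'a set \<Rightarrow> 'a set set \<Rightarrow> bool" where
  "B_factorizable V E \<longleftrightarrow>
     (\<forall>v \<in> Nbar V (PM V). (\<forall>e \<in> pairsK V. v (Inl e) = chiK E e) \<longrightarrow> v \<in> Ncomb (PM V))"

end

theory Submission
  imports Defs
begin

text \<open>
  Let \<open>n\<close> be the restriction of \<open>v\<close> to the equal partitions. Counting edges gives \<open>\<Sum>c. n c = 5\<close>.
  Every perfect matching crosses every partition \<open>d\<close> at least once, because its parts are odd, and
  the matchings assigned to \<open>d\<close> itself cross it three times; as \<open>B\<^sub>d\<close> has 9 edges,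
  \<open>5 + 2 * n d \<le> 9\<close>, so \<open>n d \<le> 2\<close>. Finally, every edge crosses some \<open>c\<close> with \<open>n c > 0\<close>.

  These conditions already suffice for an integral solution. The graph \<open>K\<^sub>6\<close> has six
  one-factorizations, and each of them contains exactly two perfect matchings of each \<open>B\<^sub>c\<close>.
  For every 5-multiset of partitions satisfying the conditions, in at least one of the six
  the five partitions have a system of distinct representatives among the five matchings;
  this is verified by running through all 2002 multisets.
\<close>

section \<open>Necessary conditions\<close>

text \<open>A linear inequality that holds on the generators passes to nonnegative combinations, and
  the factor \<open>k\<close> cancels because \<open>k \<ge> 1\<close>. All necessary conditions on
  \<open>v\<close> are obtained this way.\<close>

lemma Nbar_sum_le:
  assumes v: "v \<in> Nbar V M"
    and le: "\<And>m. m \<in> M \<Longrightarrow> (\<Sum>i\<in>I. a i * m i) \<le> (\<Sum>i\<in>J. b i * m i)"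
  shows "(\<Sum>i\<in>I. a i * v i) \<le> (\<Sum>i\<in>J. b i * v i)"
proof -
  obtain k S f where k: "k \<ge> 1" and S: "S \<subseteq> M"
    and eq: "(\<lambda>i. k * v i) = (\<lambda>i. \<Sum>m\<in>S. f m * m i)"
    using v unfolding Nbar_def Ncomb_def by blast
  have lin: "k * (\<Sum>i\<in>X. w i * v i) = (\<Sum>m\<in>S. f m * (\<Sum>i\<in>X. w i * m i))" for X w
  proof -
    have "k * (\<Sum>i\<in>X. w i * v i) = (\<Sum>i\<in>X. w i * (k * v i))"
      by (simp add: sum_distrib_left ac_simps)
    also have "\<dots> = (\<Sum>i\<in>X. w i * (\<Sum>m\<in>S. f m * m i))"
      using eq by (simp add: fun_eq_iff)
    also have "\<dots> = (\<Sum>i\<in>X. \<Sum>m\<in>S. f m * (w i * m i))"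
      by (simp add: sum_distrib_left ac_simps)
    also have "\<dots> = (\<Sum>m\<in>S. f m * (\<Sum>i\<in>X. w i * m i))"
      by (subst sum.swap) (simp add: sum_distrib_left)
    finally show ?thesis .
  qed
  have "k * (\<Sum>i\<in>I. a i * v i) \<le> k * (\<Sum>i\<in>J. b i * v i)"
    unfolding lin using S le by (intro sum_mono mult_left_mono) auto
  with k show ?thesis by simp
qed

lemma sum_list_in_Ncomb:
  assumes "set ms \<subseteq> M"
  shows "(\<lambda>i. \<Sum>m\<leftarrow>ms. m i) \<in> Ncomb M"
  unfolding Ncomb_def using assms
  by (auto simp: sum_list_map_eq_sum_count intro!: exI[of _ "set ms"] exI[of _ "count_list ms"])

lemma sum_chiEc_Inl:
  "finite X \<Longrightarrow> (\<Sum>e\<in>X. chiEc q c (Inl e)) = card (X \<inter> q)"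
  by (simp add: chiEc_def sum.If_cases)

lemma sum_chiEc_Inr:
  "finite Y \<Longrightarrow> (\<Sum>d\<in>Y. b d * chiEc q c (Inr d)) = (if c \<in> Y then b c else 0)"
  by (simp add: chiEc_def if_distrib cong: if_cong)

section \<open>Cuts and perfect matchings\<close>

lemma finite_pairsK: "finite V \<Longrightarrow> finite (pairsK V)"
  unfolding pairsK_def by simp

lemma finite_eqparts: "finite V \<Longrightarrow> finite (eqparts V)"
proof -
  assume "finite V"
  moreover have "eqparts V \<subseteq> (\<lambda>H. {H, V - H}) ` Pow V"
    unfolding eqparts_def by auto
  ultimately show ?thesis by (meson finite_Pow_iff finite_imageI finite_subset)
qed

text \<open>\<open>bip_edges\<close> allows both orders of the two parts; swapping the endpoints
  lets the first one be taken in \<open>H\<close>.\<close>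

lemma in_bip_edges_iff:
  "e \<in> bip_edges {H, V - H} \<longleftrightarrow> (\<exists>x\<in>H. \<exists>y\<in>V - H. e = {x, y})"
proof
  assume "e \<in> bip_edges {H, V - H}"
  then obtain x y X Y where e: "e = {x, y}" and X: "X \<in> {H, V - H}" and Y: "Y \<in> {H, V - H}"
    and neq: "X \<noteq> Y" and x: "x \<in> X" and y: "y \<in> Y"
    unfolding bip_edges_def by blast
  show "\<exists>x\<in>H. \<exists>y\<in>V - H. e = {x, y}"
  proof (cases "X = H")
    case True
    with Y neq have "Y = V - H" by simp
    with True show ?thesis using e x y by blast
  next
    case False
    with X have "X = V - H" by simp
    with Y neq have "Y = H" by simp
    with \<open>X = V - H\<close> have "x \<in> V - H" "y \<in> H" "e = {y, x}" using e x y by auto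
    then show ?thesis by blast
  qed
next
  assume "\<exists>x\<in>H. \<exists>y\<in>V - H. e = {x, y}"
  then obtain x y where xy: "x \<in> H" "y \<in> V - H" "e = {x, y}" by blast
  then have "H \<noteq> V - H" by blast
  with xy show "e \<in> bip_edges {H, V - H}"
    unfolding bip_edges_def mem_Collect_eq by (intro exI[of _ x] exI[of _ y]) simp
qed

lemma card_bip_edges:
  assumes "finite V" "H \<subseteq> V"
  shows "card (bip_edges {H, V - H}) = card H * card (V - H)"
proof -
  have "bip_edges {H, V - H} = (\<lambda>(x, y). {x, y}) ` (H \<times> (V - H))"
    by (intro set_eqI) (simp add: in_bip_edges_iff image_iff)
  moreover have "inj_on (\<lambda>(x, y). {x, y}) (H \<times> (V - H))"
    by (auto simp: inj_on_def doubleton_eq_iff)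
  ultimately show ?thesis by (simp add: card_image card_cartesian_product)
qed

lemma bip_edges_subset_pairsK:
  assumes "c \<in> eqparts V"
  shows "bip_edges c \<subseteq> pairsK V"
proof -
  obtain H where "c = {H, V - H}" "H \<subseteq> V"
    using assms unfolding eqparts_def mem_Collect_eq by (elim exE conjE)
  show ?thesis
  proof
    fix e assume "e \<in> bip_edges c"
    then have "e \<in> bip_edges {H, V - H}" using \<open>c = {H, V - H}\<close> by simp
    then obtain x y where "x \<in> H" "y \<in> V - H" "e = {x, y}"
      unfolding in_bip_edges_iff by blast
    then show "e \<in> pairsK V"
      using \<open>H \<subseteq> V\<close> unfolding pairsK_def by (auto simp: card_insert_if)
  qed
qed

text \<open>Each vertex of \<open>D\<close> lies in exactly one edge of \<open>q\<close>, so the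
  sets \<open>e \<inter> D\<close> partition \<open>D\<close>.\<close>

lemma sum_card_Int_perfect_matching:
  assumes "finite V" "c \<in> eqparts V" and pm: "perfect_matching_B V c q" and D: "D \<subseteq> V"
  shows "(\<Sum>e\<in>q. card (e \<inter> D)) = card D"
proof -
  have q: "q \<subseteq> pairsK V"
    using bip_edges_subset_pairsK[OF assms(2)] pm unfolding perfect_matching_B_def by blast
  have ex: "\<exists>e\<in>q. x \<in> e" if "x \<in> D" for x
    using pm that D unfolding perfect_matching_B_def by blast
  have uniq: "e = e'" if "e \<in> q" "e' \<in> q" "x \<in> e" "x \<in> e'" "x \<in> D" for x e e'
    using pm that D unfolding perfect_matching_B_def by blast
  have "D = (\<Union>e\<in>q. e \<inter> D)" using ex by auto
  moreover have "card (\<Union>e\<in>q. e \<inter> D) = (\<Sum>e\<in>q. card (e \<inter> D))"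
  proof (rule card_UN_disjoint)
    show "finite q" using q finite_pairsK[OF assms(1)] finite_subset by blast
    show "\<forall>e\<in>q. finite (e \<inter> D)" using D assms(1) finite_subset by blast
    show "\<forall>e\<in>q. \<forall>e'\<in>q. e \<noteq> e' \<longrightarrow> e \<inter> D \<inter> (e' \<inter> D) = {}" using uniq by blast
  qed
  ultimately show ?thesis by simp
qed

text \<open>Every edge of \<open>q\<close> has exactly one end in \<open>H\<close>, so
  \<open>q\<close> and \<open>H\<close> are equally large.\<close>

lemma card_perfect_matching:
  assumes "finite V" "c \<in> eqparts V" and pm: "perfect_matching_B V c q"
  shows "2 * card q = card V"
proof -
  obtain H where H: "c = {H, V - H}" "H \<subseteq> V" "2 * card H = card V"
    using assms(2) unfolding eqparts_def mem_Collect_eq by (elim exE conjE)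
  have "card (e \<inter> H) = 1" if "e \<in> q" for e
  proof -
    have "e \<in> bip_edges {H, V - H}"
      using that pm unfolding H(1)[symmetric] perfect_matching_B_def by blast
    then obtain x y where "x \<in> H" "y \<in> V - H" "e = {x, y}" unfolding in_bip_edges_iff by blast
    then have "e \<inter> H = {x}" by blast
    then show ?thesis by simp
  qed
  then show ?thesis
    using sum_card_Int_perfect_matching[OF assms H(2)] H(3) by simp
qed

text \<open>Without a crossing edge, each edge of \<open>q\<close> would meet \<open>D\<close> in 0
  or 2 points, and \<open>card D\<close> would be even.\<close>

lemma perfect_matching_meets_odd_cut:
  assumes "finite V" "c \<in> eqparts V" and pm: "perfect_matching_B V c q"
    and D: "D \<subseteq> V" "odd (card D)"
  shows "q \<inter> bip_edges {D, V - D} \<noteq> {}"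
proof
  assume none: "q \<inter> bip_edges {D, V - D} = {}"
  have "even (card (e \<inter> D))" if "e \<in> q" for e
  proof -
    have "e \<in> pairsK V"
      using bip_edges_subset_pairsK[OF assms(2)] pm that unfolding perfect_matching_B_def by blast
    then obtain x y where e: "e = {x, y}" "x \<noteq> y" "x \<in> V" "y \<in> V"
      unfolding pairsK_def card_2_iff by auto
    have "x \<in> D \<longleftrightarrow> y \<in> D"
    proof (rule ccontr)
      assume "(x \<in> D) \<noteq> (y \<in> D)"
      then have "e \<in> bip_edges {D, V - D}"
        unfolding in_bip_edges_iff using e by (auto simp: insert_commute)
      then show False using none that by blast
    qed
    then have "e \<inter> D = {} \<or> e \<inter> D = {x, y}" using e by auto
    then show ?thesis using e by auto
  qed
  then have "even (\<Sum>e\<in>q. card (e \<inter> D))" by (rule dvd_sum)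
  then show False using sum_card_Int_perfect_matching[OF assms(1-3) D(1)] D(2) by simp
qed

section \<open>Inequalities on six vertices\<close>

context
  fixes V :: "'a set" and v :: "'a vec"
  assumes fin: "finite V" and card6: "card V = 6"
    and v: "v \<in> Nbar V (PM V)" and v1: "\<And>e. e \<in> pairsK V \<Longrightarrow> v (Inl e) = 1"
begin

lemma sum_eqparts_eq_5: "(\<Sum>c\<in>eqparts V. v (Inr c)) = 5"
proof -
  let ?K = "Inl ` pairsK V" and ?C = "Inr ` eqparts V"
  \<comment> \<open>A generator has three edges and one partition, whence the weights 1 and
    3.\<close>
  have eq: "(\<Sum>i\<in>?K. 1 * m i) = (\<Sum>i\<in>?C. 3 * m i)" if mPM: "m \<in> PM V" for m
  proof -
    obtain q c where m: "m = chiEc q c" and c: "c \<in> eqparts V" and pm: "perfect_matching_B V c q"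
      using mPM unfolding PM_def by blast
    have "pairsK V \<inter> q = q"
      using bip_edges_subset_pairsK[OF c] pm unfolding perfect_matching_B_def by blast
    then show ?thesis
      using card_perfect_matching[OF fin c pm] card6 c
      by (simp add: sum.reindex m sum_chiEc_Inl sum_chiEc_Inr finite_pairsK finite_eqparts fin)
  qed
  have "card (pairsK V) = 15"
    unfolding pairsK_def using n_subsets[OF fin, of 2] card6 by (simp add: choose_two)
  then have "(\<Sum>i\<in>?K. 1 * v i) = 15" by (simp add: sum.reindex v1)
  moreover have "(\<Sum>i\<in>?K. 1 * v i) = (\<Sum>i\<in>?C. 3 * v i)"
    by (intro antisym Nbar_sum_le[OF v]) (simp_all only: eq order_refl)
  ultimately show ?thesis by (simp add: sum.reindex flip: sum_distrib_left)
qed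

lemma eqparts_le_2:
  assumes d: "d \<in> eqparts V"
  shows "v (Inr d) \<le> 2"
proof -
  obtain D where D: "d = {D, V - D}" "D \<subseteq> V" "2 * card D = card V"
    using d unfolding eqparts_def mem_Collect_eq by (elim exE conjE)
  then have "card D = 3" using card6 by simp
  have cardB: "card (bip_edges d) = 9"
    using card_bip_edges[OF fin D(2)] D \<open>card D = 3\<close> card6 fin by (simp add: card_Diff_subset finite_subset)
  then have finB: "finite (bip_edges d)" by (simp add: card_ge_0_finite)
  \<comment> \<open>\<open>w\<close> bounds from below how many edges of \<open>bip_edges d\<close>
    a generator uses: all three of its edges if its partition is \<open>d\<close>, otherwise at
    least one by parity.\<close>
  define w :: "'a coord \<Rightarrow> nat" where "w i = (if i = Inr d then 3 else 1)" for i
  let ?B = "Inl ` bip_edges d" and ?C = "Inr ` eqparts V"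
  have "(\<Sum>i\<in>?C. w i * v i) \<le> (\<Sum>i\<in>?B. 1 * v i)"
  proof (rule Nbar_sum_le[OF v])
    fix m assume "m \<in> PM V"
    then obtain q c where m: "m = chiEc q c" and c: "c \<in> eqparts V" and pm: "perfect_matching_B V c q"
      unfolding PM_def by blast
    have "w (Inr c) \<le> card (bip_edges d \<inter> q)"
    proof (cases "c = d")
      case True
      then have "bip_edges d \<inter> q = q" using pm unfolding perfect_matching_B_def by blast
      then show ?thesis using card_perfect_matching[OF fin c pm] card6 True by (simp add: w_def)
    next
      case False
      have "bip_edges d \<inter> q \<noteq> {}"
        using perfect_matching_meets_odd_cut[OF fin c pm D(2)] D(1) \<open>card D = 3\<close> by (simp add: Int_commute)
      then show ?thesis using finB False by (simp add: w_def Suc_le_eq card_gt_0_iff)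
    qed
    then show "(\<Sum>i\<in>?C. w i * m i) \<le> (\<Sum>i\<in>?B. 1 * m i)"
      using c by (simp add: sum.reindex m sum_chiEc_Inl sum_chiEc_Inr[where b = "\<lambda>c. w (Inr c)"]
          finB finite_eqparts fin)
  qed
  moreover have "(\<Sum>i\<in>?B. 1 * v i) = 9"
    using bip_edges_subset_pairsK[OF d] cardB by (simp add: sum.reindex v1 subset_iff)
  moreover have "(\<Sum>i\<in>?C. w i * v i) = 5 + 2 * v (Inr d)"
  proof -
    have "(\<Sum>i\<in>?C. w i * v i) = (\<Sum>c\<in>eqparts V. v (Inr c) + (if c = d then 2 * v (Inr c) else 0))"
      by (auto simp: sum.reindex w_def intro!: sum.cong)
    then show ?thesis using d by (simp add: sum.distrib sum_eqparts_eq_5 finite_eqparts fin)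
  qed
  ultimately show ?thesis by simp
qed

text \<open>A generator containing \<open>e\<close> has its partition in \<open>Y\<close>, the set
  of partitions crossed by \<open>e\<close>. Hence \<open>v (Inl e)\<close>, which is 1, is at most
  the total of \<open>v\<close> over \<open>Y\<close>.\<close>

lemma edge_crossed:
  assumes e: "e \<in> pairsK V"
  shows "\<exists>c\<in>eqparts V. e \<in> bip_edges c \<and> v (Inr c) \<noteq> 0"
proof (rule ccontr)
  assume none: "\<not> ?thesis"
  define Y where "Y = {c \<in> eqparts V. e \<in> bip_edges c}"
  have finY: "finite Y" unfolding Y_def using finite_eqparts[OF fin] by simp
  have "(\<Sum>i\<in>{Inl e}. 1 * v i) \<le> (\<Sum>i\<in>Inr ` Y. 1 * v i)"
  proof (rule Nbar_sum_le[OF v])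
    fix m assume "m \<in> PM V"
    then obtain q c where m: "m = chiEc q c" and c: "c \<in> eqparts V" and pm: "perfect_matching_B V c q"
      unfolding PM_def by blast
    have "c \<in> Y" if "e \<in> q"
      using pm c that unfolding perfect_matching_B_def Y_def by blast
    then show "(\<Sum>i\<in>{Inl e}. 1 * m i) \<le> (\<Sum>i\<in>Inr ` Y. 1 * m i)"
      using sum_chiEc_Inr[OF finY, of "\<lambda>_. 1" q c]
      by (simp add: sum.reindex m) (simp add: chiEc_def)
  qed
  moreover have "(\<Sum>i\<in>Inr ` Y. 1 * v i) = 0"
    using none by (auto simp: sum.reindex Y_def)
  ultimately show False using v1[OF e] by simp
qed

end

section \<open>Six-point model\<close>

datatype pt = P0 | P1 | P2 | P3 | P4 | P5

text \<open>The pair \<open>(a, b)\<close> stands for the equal partition with parts \<open>{P0, a, b}\<close> and its complement.\<close>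

definition halves :: "(pt \<times> pt) list" where
  "halves = [(P1, P2), (P1, P3), (P1, P4), (P1, P5), (P2, P3),
             (P2, P4), (P2, P5), (P3, P4), (P3, P5), (P4, P5)]"

definition days :: "pt list" where
  "days = [P1, P2, P3, P4, P5]"

text \<open>The ten edges avoiding \<open>P0\<close> are the pairs of points of \<open>days\<close>,
  which are also the entries of \<open>halves\<close>. Each edge is listed in one orientation
  only.\<close>

definition edges :: "(pt \<times> pt) list" where
  "edges = map (Pair P0) days @ halves"

text \<open>
  The six one-factorizations are indexed by \<open>pt\<close>; the matching \<open>factor t i\<close> of the one numbered \<open>t\<close>
  is the one that contains the edge \<open>(P0, i)\<close>. Thus \<open>i\<close> ranges over \<open>days\<close>.
\<close>

fun factor :: "pt \<Rightarrow> pt \<Rightarrow> (pt \<times> pt) list" where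
  "factor P0 P1 = [(P0, P1), (P2, P3), (P4, P5)]"
| "factor P0 P2 = [(P0, P2), (P1, P4), (P3, P5)]"
| "factor P0 P3 = [(P0, P3), (P1, P5), (P2, P4)]"
| "factor P0 P4 = [(P0, P4), (P1, P3), (P2, P5)]"
| "factor P0 P5 = [(P0, P5), (P1, P2), (P3, P4)]"
| "factor P1 P1 = [(P0, P1), (P2, P3), (P4, P5)]"
| "factor P1 P2 = [(P0, P2), (P1, P5), (P3, P4)]"
| "factor P1 P3 = [(P0, P3), (P1, P4), (P2, P5)]"
| "factor P1 P4 = [(P0, P4), (P1, P2), (P3, P5)]"
| "factor P1 P5 = [(P0, P5), (P1, P3), (P2, P4)]"
| "factor P2 P1 = [(P0, P1), (P2, P4), (P3, P5)]"
| "factor P2 P2 = [(P0, P2), (P1, P3), (P4, P5)]"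
| "factor P2 P3 = [(P0, P3), (P1, P4), (P2, P5)]"
| "factor P2 P4 = [(P0, P4), (P1, P5), (P2, P3)]"
| "factor P2 P5 = [(P0, P5), (P1, P2), (P3, P4)]"
| "factor P3 P1 = [(P0, P1), (P2, P4), (P3, P5)]"
| "factor P3 P2 = [(P0, P2), (P1, P5), (P3, P4)]"
| "factor P3 P3 = [(P0, P3), (P1, P2), (P4, P5)]"
| "factor P3 P4 = [(P0, P4), (P1, P3), (P2, P5)]"
| "factor P3 P5 = [(P0, P5), (P1, P4), (P2, P3)]"
| "factor P4 P1 = [(P0, P1), (P2, P5), (P3, P4)]"
| "factor P4 P2 = [(P0, P2), (P1, P3), (P4, P5)]"
| "factor P4 P3 = [(P0, P3), (P1, P5), (P2, P4)]"
| "factor P4 P4 = [(P0, P4), (P1, P2), (P3, P5)]"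
| "factor P4 P5 = [(P0, P5), (P1, P4), (P2, P3)]"
| "factor P5 P1 = [(P0, P1), (P2, P5), (P3, P4)]"
| "factor P5 P2 = [(P0, P2), (P1, P4), (P3, P5)]"
| "factor P5 P3 = [(P0, P3), (P1, P2), (P4, P5)]"
| "factor P5 P4 = [(P0, P4), (P1, P5), (P2, P3)]"
| "factor P5 P5 = [(P0, P5), (P1, P3), (P2, P4)]"
| "factor _ P0 = []"

definition in_half :: "pt \<times> pt \<Rightarrow> pt \<Rightarrow> bool" where
  "in_half h x \<longleftrightarrow> x = P0 \<or> x = fst h \<or> x = snd h"

definition crosses :: "pt \<times> pt \<Rightarrow> pt \<times> pt \<Rightarrow> bool" where
  "crosses h p \<longleftrightarrow> in_half h (fst p) \<noteq> in_half h (snd p)"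

text \<open>A backtracking search for distinct representatives: each list entry, repeated ones
  included, needs its own \<open>q\<close> outside \<open>used\<close>.\<close>

fun has_sdr :: "('d \<Rightarrow> 'q \<Rightarrow> bool) \<Rightarrow> 'q list \<Rightarrow> 'q list \<Rightarrow> 'd list \<Rightarrow> bool" where
  "has_sdr R qs used [] \<longleftrightarrow> True"
| "has_sdr R qs used (d # ds) \<longleftrightarrow>
     list_ex (\<lambda>q. \<not> List.member used q \<and> R d q \<and> has_sdr R qs (q # used) ds) qs"

text \<open>For \<open>i\<close> in \<open>days\<close> this means that \<open>factor t i\<close> is
  a perfect matching of the bipartite graph of \<open>h\<close>.\<close>

definition compatible :: "pt \<Rightarrow> pt \<times> pt \<Rightarrow> pt \<Rightarrow> bool" where
  "compatible t h i \<longleftrightarrow> list_all (crosses h) (factor t i)"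

definition solvable :: "(pt \<times> pt) list \<Rightarrow> bool" where
  "solvable hs \<longleftrightarrow> list_ex (\<lambda>t. has_sdr (compatible t) days [] hs) (P0 # days)"

text \<open>The conclusions of \<open>eqparts_le_2\<close> and \<open>edge_crossed\<close> in a form
  decidable by evaluation, with the multiset of partitions given as a list.\<close>

definition admissible :: "(pt \<times> pt) list \<Rightarrow> bool" where
  "admissible hs \<longleftrightarrow> list_all (\<lambda>h. count_list hs h \<le> 2) hs \<and>
     list_all (\<lambda>p. list_ex (\<lambda>h. crosses h p) hs) edges"

section \<open>Exhaustive check\<close>

text \<open>
  The recursion never builds the list of all multisets, since the simplifier would traverse it
  again at every step of the evaluation.
\<close>

fun all_multisets :: "('b list \<Rightarrow> bool) \<Rightarrow> nat \<Rightarrow> 'b list \<Rightarrow> 'b list \<Rightarrow> bool" where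
  "all_multisets P 0 xs acc \<longleftrightarrow> P acc"
| "all_multisets P (Suc k) [] acc \<longleftrightarrow> True"
| "all_multisets P (Suc k) (x # xs) acc \<longleftrightarrow>
     all_multisets P k (x # xs) (x # acc) \<and> all_multisets P (Suc k) xs acc"

text \<open>The finite core of the proof. The 5-multisets of the ten partitions number 14 choose 5,
  and the evaluation visits each once.\<close>

lemma admissible_imp_solvable:
  "all_multisets (\<lambda>hs. \<not> admissible hs \<or> solvable hs) 5 halves []"
  by code_simp

text \<open>The multiplicities \<open>n\<close> select the branch of the recursion: \<open>x\<close>
  is dropped when \<open>n x = 0\<close>, and otherwise one copy of it is taken.\<close>

lemma all_multisets_ex:
  assumes "all_multisets P k xs acc" "distinct xs" "(\<Sum>x\<in>set xs. n x) = k"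
  shows "\<exists>hs. P (hs @ acc) \<and> set hs \<subseteq> set xs \<and> (\<forall>x\<in>set xs. count_list hs x = n x)"
  using assms
proof (induction P k xs acc arbitrary: n rule: all_multisets.induct)
  case (1 P xs acc)
  then show ?case by (intro exI[of _ "[]"]) simp
next
  case (2 P k acc)
  then show ?case by simp
next
  case (3 P k x xs acc)
  show ?case
  proof (cases "n x")
    case 0
    then obtain hs where hs: "P (hs @ acc)" "set hs \<subseteq> set xs" "\<forall>x\<in>set xs. count_list hs x = n x"
      using 3 by fastforce
    moreover have "count_list hs x = 0" using hs(2) 3 by (auto simp: count_list_0_iff)
    ultimately show ?thesis using 0 by (intro exI[of _ hs]) auto
  next
    case (Suc j)
    have "(\<Sum>y\<in>set xs. (n(x := j)) y) = (\<Sum>y\<in>set xs. n y)"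
      using 3 by (intro sum.cong) auto
    then have "(\<Sum>y\<in>set (x # xs). (n(x := j)) y) = k" using 3 Suc by simp
    then obtain hs where hs: "P (hs @ x # acc)" "set hs \<subseteq> set (x # xs)"
      "\<forall>y\<in>set (x # xs). count_list hs y = (n(x := j)) y"
      using 3 by (metis all_multisets.simps(3))
    \<comment> \<open>The copy of \<open>x\<close> was pushed onto the accumulator, which stands
      behind \<open>hs\<close>; so it goes to the end of the witness.\<close>
    then show ?thesis using Suc by (intro exI[of _ "hs @ [x]"]) auto
  qed
qed

text \<open>A chosen \<open>q\<close> joins \<open>used\<close>, so later representatives avoid
  it.\<close>

lemma has_sdr_ex:
  "has_sdr R qs used ds \<Longrightarrow>
    \<exists>ps. list_all2 R ds ps \<and> distinct ps \<and> set ps \<subseteq> set qs - set used"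
proof (induction ds arbitrary: used)
  case Nil
  then show ?case by (intro exI[of _ "[]"]) simp
next
  case (Cons d ds)
  then obtain q where q: "q \<in> set qs" "q \<notin> set used" "R d q" "has_sdr R qs (q # used) ds"
    by (auto simp: list_ex_iff)
  from Cons.IH[OF q(4)] obtain ps where "list_all2 R ds ps" "distinct ps"
    "set ps \<subseteq> set qs - set (q # used)" by blast
  with q show ?case by (intro exI[of _ "q # ps"]) auto
qed

section \<open>Properties of the tables\<close>

lemma UNIV_pt: "UNIV = set (P0 # days)"
  by (auto simp: days_def intro: pt.exhaust)

lemma factor_subset_edges: "set (factor t i) \<subseteq> set edges"
  by (cases t; cases i) (simp_all add: edges_def days_def halves_def)

lemma factor_covers:
  assumes "i \<in> set days"
  shows "\<exists>!p. p \<in> set (factor t i) \<and> (x = fst p \<or> x = snd p)"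
proof -
  have "list_all (\<lambda>t. list_all (\<lambda>i. list_all (\<lambda>x.
      length (filter (\<lambda>p. x = fst p \<or> x = snd p) (factor t i)) = 1) (P0 # days)) days) (P0 # days)"
    by code_simp
  then have "length (filter (\<lambda>p. x = fst p \<or> x = snd p) (factor t i)) = 1"
    using assms unfolding list_all_iff UNIV_pt[symmetric] by simp
  then obtain p where "filter (\<lambda>p. x = fst p \<or> x = snd p) (factor t i) = [p]"
    by (auto simp: length_Suc_conv)
  then have "{p \<in> set (factor t i). x = fst p \<or> x = snd p} = {p}"
    using set_filter[of "\<lambda>p. x = fst p \<or> x = snd p" "factor t i"] by simp
  then show ?thesis by (intro ex1I[of _ p]) blast+
qed

text \<open>The one-factorization property, which later makes every edge coordinate of the
  constructed sum equal to 1.\<close>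

lemma factor_factorizes:
  assumes "p \<in> set edges"
  shows "card {i \<in> set days. p \<in> set (factor t i)} = 1"
proof -
  have "list_all (\<lambda>t. list_all (\<lambda>p. length (filter (\<lambda>i. List.member (factor t i) p) days) = 1) edges)
      (P0 # days)"
    by code_simp
  then have "length (filter (\<lambda>i. p \<in> set (factor t i)) days) = 1"
    using assms unfolding list_all_iff UNIV_pt[symmetric] by simp
  moreover have "distinct days" by (simp add: days_def)
  ultimately show ?thesis
    using distinct_card[of "filter (\<lambda>i. p \<in> set (factor t i)) days"] by simp
qed

lemma edge_orientation: "x \<noteq> y \<Longrightarrow> (x, y) \<in> set edges \<or> (y, x) \<in> set edges"
  by (cases x; cases y) (simp_all add: edges_def days_def halves_def)

lemma edges_antisym: "(x, y) \<in> set edges \<Longrightarrow> x \<noteq> y \<and> (y, x) \<notin> set edges"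
  by (cases x; cases y) (simp_all add: edges_def days_def halves_def)

lemma halves_distinguished:
  assumes "h \<in> set halves" "h' \<in> set halves" "in_half h = in_half h'"
  shows "h = h'"
proof -
  \<comment> \<open>A distinguishing point can be sought in \<open>days\<close>, since
    \<open>P0\<close> belongs to every half.\<close>
  have "list_all (\<lambda>h. list_all (\<lambda>h'. h = h' \<or> list_ex (\<lambda>x. in_half h x \<noteq> in_half h' x) days) halves) halves"
    by code_simp
  then have "h = h' \<or> (\<exists>x. in_half h x \<noteq> in_half h' x)"
    using assms(1,2) unfolding list_all_iff list_ex_iff by blast
  then show ?thesis using assms(3) by auto
qed

lemma card_in_half: "h \<in> set halves \<Longrightarrow> card {x. in_half h x} = 3"
proof -
  have "{x. in_half h x} = {P0, fst h, snd h}" unfolding in_half_def by auto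
  then show "h \<in> set halves \<Longrightarrow> ?thesis" by (auto simp: halves_def)
qed

text \<open>The two points of \<open>D\<close> other than \<open>P0\<close> occur in
  \<open>halves\<close> in one order, and \<open>in_half\<close> is symmetric in them.\<close>

lemma halves_exhaust:
  assumes "card D = 3" "P0 \<in> D"
  shows "\<exists>h\<in>set halves. D = {x. in_half h x}"
proof -
  have "card (D - {P0}) = 2" using assms by simp
  then obtain a b where ab: "D - {P0} = {a, b}" "a \<noteq> b" by (meson card_2_iff)
  then have "a \<noteq> P0" "b \<noteq> P0" and D: "D = {P0, a, b}" using assms by auto
  then have "(a, b) \<in> set halves \<or> (b, a) \<in> set halves"
    using \<open>a \<noteq> b\<close> by (cases a; cases b) (simp_all add: halves_def)
  moreover have "D = {x. in_half (a, b) x}" "D = {x. in_half (b, a) x}"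
    unfolding D in_half_def by auto
  ultimately show ?thesis by blast
qed

section \<open>Labelled vertex sets\<close>

definition edge :: "(pt \<Rightarrow> 'a) \<Rightarrow> pt \<times> pt \<Rightarrow> 'a set" where
  "edge f p = {f (fst p), f (snd p)}"

definition part :: "(pt \<Rightarrow> 'a) \<Rightarrow> pt \<times> pt \<Rightarrow> 'a set set" where
  "part f h = {f ` {x. in_half h x}, range f - f ` {x. in_half h x}}"

section \<open>Partitions and edges under a labelling\<close>

context
  fixes f :: "pt \<Rightarrow> 'a"
  assumes inj: "inj f"
begin

lemma finite_range_pt: "finite (range f)"
  using UNIV_pt by (metis List.finite_set finite_imageI)

lemma card_range_pt: "card (range f) = 6"
proof -
  have "card (UNIV :: pt set) = 6" unfolding UNIV_pt by (simp add: days_def)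
  then show ?thesis using inj by (simp add: card_image)
qed

lemma card_image_half: "h \<in> set halves \<Longrightarrow> card (f ` {x. in_half h x}) = 3"
  using inj by (metis card_image card_in_half inj_on_subset subset_UNIV)

lemma part_in_eqparts: "h \<in> set halves \<Longrightarrow> part f h \<in> eqparts (range f)"
  unfolding part_def eqparts_def mem_Collect_eq
  by (intro exI[of _ "f ` {x. in_half h x}"]) (simp add: card_image_half card_range_pt image_mono)

lemma eqparts_range: "eqparts (range f) = part f ` set halves"
proof
  show "part f ` set halves \<subseteq> eqparts (range f)" using part_in_eqparts by blast
  show "eqparts (range f) \<subseteq> part f ` set halves"
  proof
    fix c assume "c \<in> eqparts (range f)"
    then obtain H where c: "c = {H, range f - H}" and H: "H \<subseteq> range f" "2 * card H = card (range f)"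
      unfolding eqparts_def mem_Collect_eq by (elim exE conjE)
    have H3: "card H = 3" using H(2) card_range_pt by simp
    have R3: "card (range f - H) = 3"
      using H H3 finite_range_pt card_range_pt by (simp add: card_Diff_subset finite_subset)
    \<comment> \<open>Of the two parts, \<open>G\<close> is the one containing \<open>f P0\<close>,
      as in the convention for \<open>halves\<close>.\<close>
    define G where "G = (if f P0 \<in> H then H else range f - H)"
    have G: "G \<subseteq> range f" "card G = 3" "f P0 \<in> G" using H H3 R3 by (auto simp: G_def)
    have cG: "c = {G, range f - G}"
      using c H(1) by (simp add: G_def double_diff insert_commute)
    have fG: "f ` (f -` G) = G" using G(1) by (simp add: image_vimage_eq Int_absorb2)
    then have "card (f -` G) = 3"
      using G(2) inj by (metis card_image inj_on_subset subset_UNIV)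
    then obtain h where h: "h \<in> set halves" "f -` G = {x. in_half h x}"
      using halves_exhaust[of "f -` G"] G(3) by auto
    then have "c = part f h" using cG fG unfolding part_def by simp
    then show "c \<in> part f ` set halves" using h(1) by blast
  qed
qed

text \<open>\<open>f P0\<close> lies in the chosen half and not in its complement, so the unordered
  pair still reveals the half.\<close>

lemma inj_on_part: "inj_on (part f) (set halves)"
proof (rule inj_onI)
  fix h h' assume h: "h \<in> set halves" "h' \<in> set halves" and eq: "part f h = part f h'"
  have P0: "f P0 \<in> f ` {x. in_half g x}" for g by (simp add: in_half_def)
  have "f ` {x. in_half h x} \<in> part f h'" unfolding eq[symmetric] by (simp add: part_def)
  then have "f ` {x. in_half h x} = f ` {x. in_half h' x}"
    using P0[of h] P0[of h'] unfolding part_def insert_iff empty_iff by (metis DiffD2)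
  then have "{x. in_half h x} = {x. in_half h' x}" using inj by (simp add: inj_image_eq_iff)
  then have "in_half h = in_half h'" by (simp add: fun_eq_iff set_eq_iff)
  then show "h = h'" using halves_distinguished h by blast
qed

lemma edge_in_bip_edges_iff: "edge f p \<in> bip_edges (part f h) \<longleftrightarrow> crosses h p"
proof -
  obtain a b where p: "p = (a, b)" by (cases p)
  have mem: "f x \<in> f ` {x. in_half h x} \<longleftrightarrow> in_half h x" for x
    using inj by (simp add: inj_image_mem_iff)
  show ?thesis
  proof
    assume "edge f p \<in> bip_edges (part f h)"
    then obtain x y where "x \<in> f ` {x. in_half h x}" "y \<in> range f - f ` {x. in_half h x}"
      "{f a, f b} = {x, y}"
      unfolding part_def in_bip_edges_iff edge_def p by auto
    then have "(f a \<in> f ` {x. in_half h x}) \<noteq> (f b \<in> f ` {x. in_half h x})"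
      unfolding doubleton_eq_iff by (metis DiffD2)
    then show "crosses h p" unfolding mem crosses_def p by simp
  next
    assume "crosses h p"
    then consider "in_half h a" "\<not> in_half h b" | "in_half h b" "\<not> in_half h a"
      unfolding crosses_def p by auto
    then show "edge f p \<in> bip_edges (part f h)"
    proof cases
      case 1
      then show ?thesis unfolding part_def in_bip_edges_iff edge_def p
        by (intro bexI[of _ "f a"] bexI[of _ "f b"]) (simp_all add: mem)
    next
      case 2
      then show ?thesis unfolding part_def in_bip_edges_iff edge_def p
        by (intro bexI[of _ "f b"] bexI[of _ "f a"]) (simp_all add: mem insert_commute)
    qed
  qed
qed

text \<open>\<open>edge f\<close> forgets orientation, but \<open>edges\<close> never contains both
  orientations of a pair.\<close>

lemma inj_on_edge: "inj_on (edge f) (set edges)"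
proof (rule inj_onI)
  fix p p' assume p: "p \<in> set edges" "p' \<in> set edges" and eq: "edge f p = edge f p'"
  then have "p = p' \<or> p = (snd p', fst p')"
    using inj unfolding edge_def by (auto simp: doubleton_eq_iff inj_eq prod_eq_iff)
  then show "p = p'" using p edges_antisym[of "fst p'" "snd p'"] by auto
qed

lemma pairsK_range: "pairsK (range f) = edge f ` set edges"
proof
  show "edge f ` set edges \<subseteq> pairsK (range f)"
    using edges_antisym inj by (fastforce simp: pairsK_def edge_def card_insert_if inj_eq)
  show "pairsK (range f) \<subseteq> edge f ` set edges"
  proof
    fix e assume "e \<in> pairsK (range f)"
    then obtain x y where e: "e = {f x, f y}" "x \<noteq> y"
      unfolding pairsK_def card_2_iff by blast
    then have "e = edge f (x, y)" "e = edge f (y, x)" by (auto simp: edge_def)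
    then show "e \<in> edge f ` set edges" using edge_orientation[OF e(2)] by blast
  qed
qed

section \<open>Assembling the decomposition\<close>

lemma factor_perfect_matching:
  assumes "compatible t h i" "i \<in> set days"
  shows "perfect_matching_B (range f) (part f h) (edge f ` set (factor t i))"
  unfolding perfect_matching_B_def
proof (intro conjI ballI)
  show "edge f ` set (factor t i) \<subseteq> bip_edges (part f h)"
    using assms(1) by (auto simp: compatible_def list_all_iff edge_in_bip_edges_iff)
  fix y assume "y \<in> range f"
  then obtain x where x: "y = f x" by blast
  obtain p where p: "p \<in> set (factor t i)" "x = fst p \<or> x = snd p"
    and uniq: "\<And>p'. p' \<in> set (factor t i) \<Longrightarrow> x = fst p' \<or> x = snd p' \<Longrightarrow> p' = p"
    using factor_covers[OF assms(2), of t x] by blast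
  have mem: "y \<in> edge f p' \<longleftrightarrow> x = fst p' \<or> x = snd p'" for p'
    using inj by (simp add: edge_def x inj_eq)
  show "\<exists>!e. e \<in> edge f ` set (factor t i) \<and> y \<in> e"
  proof (rule ex1I[of _ "edge f p"])
    show "edge f p \<in> edge f ` set (factor t i) \<and> y \<in> edge f p" using p mem by blast
    show "e = edge f p" if "e \<in> edge f ` set (factor t i) \<and> y \<in> e" for e
      using that mem uniq by blast
  qed
qed

text \<open>The multiplicities in \<open>v\<close> give a list \<open>hs\<close> of five halves. The
  exhaustive check yields a one-factorization \<open>t\<close> and distinct indices
  \<open>js\<close>; pairing \<open>hs\<close> with \<open>js\<close> gives five generators with sum
  \<open>v\<close>.\<close>

lemma B_factorizable_range: "B_factorizable (range f) (pairsK (range f))"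
  unfolding B_factorizable_def
proof (intro ballI impI)
  fix v assume v: "v \<in> Nbar (range f) (PM (range f))"
    and "\<forall>e\<in>pairsK (range f). v (Inl e) = chiK (pairsK (range f)) e"
  then have v1: "v (Inl e) = 1" if "e \<in> pairsK (range f)" for e
    using that by (simp add: chiK_def)
  note nec = finite_range_pt card_range_pt v v1
  define n where "n h = v (Inr (part f h))" for h
  have "(\<Sum>h\<in>set halves. n h) = 5"
    using sum_eqparts_eq_5[OF nec] unfolding eqparts_range
    by (simp add: sum.reindex inj_on_part n_def)
  moreover have "distinct halves" by (simp add: halves_def)
  ultimately obtain hs where hs: "\<not> admissible (hs @ []) \<or> solvable (hs @ [])" "set hs \<subseteq> set halves"
    and count: "\<And>h. h \<in> set halves \<Longrightarrow> count_list hs h = n h"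
    using all_multisets_ex[OF admissible_imp_solvable] by blast
  have "admissible hs"
    unfolding admissible_def list_all_iff list_ex_iff
  proof (intro conjI ballI)
    show "count_list hs h \<le> 2" if "h \<in> set hs" for h
    proof -
      have "h \<in> set halves" using that hs(2) by blast
      then show ?thesis using count eqparts_le_2[OF nec part_in_eqparts] by (simp add: n_def)
    qed
    show "\<exists>h\<in>set hs. crosses h p" if "p \<in> set edges" for p
    proof -
      have "edge f p \<in> pairsK (range f)" using that pairsK_range by blast
      from edge_crossed[OF nec this] obtain h where h: "h \<in> set halves"
        "edge f p \<in> bip_edges (part f h)" "n h \<noteq> 0"
        unfolding eqparts_range n_def by blast
      then have "h \<in> set hs" using count[of h] count_list_0_iff[of hs h] by auto
      then show ?thesis using h(2) edge_in_bip_edges_iff by blast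
    qed
  qed
  then have "solvable hs" using hs(1) by simp
  then obtain t where "has_sdr (compatible t) days [] hs"
    unfolding solvable_def list_ex_iff by blast
  from has_sdr_ex[OF this] obtain js where R: "list_all2 (compatible t) hs js"
    and dist: "distinct js" and sub: "set js \<subseteq> set days" by auto
  have len: "length js = length hs" using R by (simp add: list_all2_lengthD)
  have "length hs = 5"
    using sum_count_set[OF hs(2)] count \<open>(\<Sum>h\<in>set halves. n h) = 5\<close> by simp
  \<comment> \<open>Five distinct indices among the five of \<open>days\<close> use each exactly
    once.\<close>
  then have is_days: "set js = set days"
    using sub dist len by (intro card_subset_eq) (simp_all add: distinct_card days_def)
  define ms where "ms = map2 (\<lambda>h i. chiEc (edge f ` set (factor t i)) (part f h)) hs js"
  have "set ms \<subseteq> PM (range f)"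
  proof
    fix m assume "m \<in> set ms"
    then obtain h i where hi: "(h, i) \<in> set (zip hs js)"
      and m: "m = chiEc (edge f ` set (factor t i)) (part f h)" by (auto simp: ms_def)
    have "h \<in> set halves" using hi hs(2) by (meson in_mono set_zip_leftD)
    moreover have "i \<in> set days" using hi sub by (meson in_mono set_zip_rightD)
    moreover have "compatible t h i" using R hi by (auto simp: list_all2_iff)
    ultimately show "m \<in> PM (range f)"
      unfolding PM_def m using part_in_eqparts factor_perfect_matching by blast
  qed
  moreover have "v = (\<lambda>i. \<Sum>m\<leftarrow>ms. m i)"
  proof
    fix c
    show "v c = (\<Sum>m\<leftarrow>ms. m c)"
    proof (cases c)
      case (Inl e)
      \<comment> \<open>Edge coordinates depend only on \<open>js\<close>, so the sum counts the
        matchings that contain \<open>e\<close>.\<close>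
      have "(\<Sum>m\<leftarrow>ms. m c) = (\<Sum>(h, i)\<leftarrow>zip hs js. if e \<in> edge f ` set (factor t i) then 1 else 0)"
        unfolding ms_def Inl by (simp add: chiEc_def comp_def case_prod_unfold)
      also have "\<dots> = (\<Sum>i\<leftarrow>map snd (zip hs js). if e \<in> edge f ` set (factor t i) then 1 else 0)"
        by (simp add: comp_def case_prod_unfold)
      also have "\<dots> = (\<Sum>i\<in>set days. if e \<in> edge f ` set (factor t i) then 1 else 0)"
        using len dist is_days by (simp add: sum_list_distinct_conv_sum_set)
      also have "\<dots> = card {i \<in> set days. e \<in> edge f ` set (factor t i)}"
        by (simp add: sum.If_cases Int_def)
      also have "\<dots> = v c"
      proof (cases "e \<in> pairsK (range f)")
        case True
        then obtain p where p: "p \<in> set edges" "e = edge f p" using pairsK_range by blast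
        then have "e \<in> edge f ` set (factor t i) \<longleftrightarrow> p \<in> set (factor t i)" for i
          using inj_on_image_mem_iff[OF inj_on_edge p(1) factor_subset_edges] by simp
        then show ?thesis using factor_factorizes[OF p(1), of t] v1[OF True] Inl by simp
      next
        case False
        then have "e \<notin> edge f ` set (factor t i)" for i
          using factor_subset_edges pairsK_range by blast
        \<comment> \<open>The two functions must also agree outside \<open>coords\<close>, where
          membership in \<open>vecs\<close> makes \<open>v\<close> vanish.\<close>
        moreover have "v (Inl e) = 0"
          using v False by (auto simp: Nbar_def vecs_def coords_def)
        ultimately show ?thesis using Inl by simp
      qed
      finally show ?thesis by simp
    next
      case (Inr d)
      \<comment> \<open>Partition coordinates depend only on \<open>hs\<close>, whose multiplicities
        were read off from \<open>v\<close>.\<close>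
      have "(\<Sum>m\<leftarrow>ms. m c) = (\<Sum>(h, i)\<leftarrow>zip hs js. if d = part f h then 1 else 0)"
        unfolding ms_def Inr by (simp add: chiEc_def comp_def case_prod_unfold)
      also have "\<dots> = (\<Sum>h\<leftarrow>map fst (zip hs js). if d = part f h then 1 else 0)"
        by (simp add: comp_def case_prod_unfold)
      also have "\<dots> = (\<Sum>h\<leftarrow>hs. if d = part f h then 1 else 0)"
        using len by simp
      also have "\<dots> = v c"
      proof (cases "d \<in> eqparts (range f)")
        case True
        then obtain g where g: "g \<in> set halves" "d = part f g" using eqparts_range by blast
        have "d = part f h \<longleftrightarrow> g = h" if "h \<in> set hs" for h
          using that g(2) hs(2) inj_on_eq_iff[OF inj_on_part g(1), of h] by blast
        then have "(\<Sum>h\<leftarrow>hs. if d = part f h then 1 else 0) = (\<Sum>h\<leftarrow>hs. if g = h then 1 else 0)"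
          by (intro arg_cong[of _ _ sum_list] map_cong) simp_all
        also have "\<dots> = count_list hs g"
          by (induction hs) auto
        finally show ?thesis using count[OF g(1)] g(2) Inr by (simp add: n_def)
      next
        case False
        then have "(\<Sum>h\<leftarrow>hs. if d = part f h then 1 else 0) = (\<Sum>h\<leftarrow>hs. 0 :: nat)"
          using hs(2) part_in_eqparts by (intro arg_cong[of _ _ sum_list] map_cong refl) (metis subsetD)
        moreover have "v (Inr d) = 0"
          using v False by (auto simp: Nbar_def vecs_def coords_def)
        ultimately show ?thesis using Inr by simp
      qed
      finally show ?thesis by simp
    qed
  qed
  ultimately show "v \<in> Ncomb (PM (range f))" using sum_list_in_Ncomb[of ms] by simp
qed

end

theorem mainTheorem8:
  fixes V :: "'a set"
  assumes "finite V" and "card V = 6"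
  shows "B_factorizable V (pairsK V)"
proof -
  have "card (UNIV :: pt set) = 6" unfolding UNIV_pt by (simp add: days_def)
  moreover have "finite (UNIV :: pt set)" unfolding UNIV_pt by simp
  \<comment> \<open>Any bijection from the six points serves as the labelling.\<close>
  ultimately obtain f :: "pt \<Rightarrow> 'a" where "bij_betw f UNIV V"
    using assms finite_same_card_bij by metis
  then have "inj f" "range f = V" by (simp_all add: bij_betw_def)
  then show ?thesis using B_factorizable_range by metis
qed

end
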